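(* Let $n>1$ and $\kappa>0$ be real numbers, let $y_{\rm ex}$ be the solution of $$y''=\kappa^2\cdot y^n,\qquad y(0)=0,\quad y(1)=1,$$ and let $C_{\rm ex}$ be the associated constant (see context). (i) The solution $y_{\rm ex}$ has boundary layer if $\kappa\geq\kappa_{\rm bl}:=36\sqrt{\dfrac{n+1}{0.9^{\,n+1}}}$. (ii) The function $$y_+(x):=\left[1+\frac{\kappa(n-1)}{\sqrt{2(n+1)}}(1-x)\right]^{-\frac{2}{n-1}}$$ is an upper envelope of $y_{\rm ex}$ on $[0,1]$, i.e. $y_{\rm ex}\leq y_+$ on $[0,1]$. (iii) Let $\xi:=\frac{n-1}{n+1}$, $$C_+:=\frac12\left[\frac{y_+(\xi)}{\kappa\xi}\right]^2=\frac{1}{2\kappa^2\xi^2}\left[1+\frac{\sqrt2(n-1)\kappa}{(n+1)^{3/2}}\right]^{-\frac{4}{n-1}},\qquad c_+:=[(n+1)C_+]^{1/(n+1)},$$ and define $$y_\bullet(x):=\left[(1+c_+)^{-\frac{n-1}{2}}+\frac{\kappa(n-1)}{\sqrt{2(n+1)}}(1-x)\right]^{-\frac{2}{n-1}}-c_+ .$$ For $\lambda:=\dfrac{y_+(0)}{y_+(0)-y_\bullet(0)}$, the function $y_-:=(1-\lambda)y_++\lambda y_\bullet$ satisfies $y_-(0)=0$ and $y_-(1)=1$. Moreover, $y_-$ has the following properties: - $y_-$ is increasing and convex on $[0,1]$, positive on $(0,1]$, and $y_+-y_-$ is decreasing on $[0,1]$; - $y_-$ is a lower envelope of $y_{\rm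 ex}$, i.e. $y_-\leq y_{\rm ex}$ on $[0,1]$. (iv) Let $$C_-:=\frac{y_+(0)^{n+1}}{n+1}=\frac{1}{n+1}\left[1+\frac{\kappa(n-1)}{\sqrt{2(n+1)}}\right]^{-\frac{2(n+1)}{n-1}}.$$ Then $C_-\leq C_{\rm ex}\leq C_+$.
   Context: The function $y_{\rm ex}:[0,1]\to[0,1]$ denotes the (exact) solution of the boundary value problem $y''=\kappa^2 y^n$, $y(0)=0$, $y(1)=1$; it is increasing and convex. Equivalently, it satisfies $$y'=\kappa\sqrt2\cdot\sqrt{\frac{y^{n+1}}{n+1}+C},\qquad y(1)=1,$$ where the constant $C=C_{\rm ex}>0$ is determined by the condition $y(0)=0$. Definition. One says that $y_{\rm ex}$ has boundary layer (at $x=1$) if $y_{\rm ex}'\big(y_{\rm ex}^{-1}(0.9)\big)>50$, where $y_{\rm ex}^{-1}$ is the inverse function of $y_{\rm ex}$. *)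

theory Defs
  imports "HOL-Analysis.Analysis"
begin

text \<open>
  The exponent \<^term>\<open>n\<close> is real, so all powers are \<^const>\<open>powr\<close>. A solution is a total
  function of which only the restriction to \<open>[0,1]\<close> matters; derivatives are taken within
  \<open>[0,1]\<close>, i.e. they are one-sided at the end points.
\<close>

definition bvp_solution :: "real \<Rightarrow> real \<Rightarrow> (real \<Rightarrow> real) \<Rightarrow> bool" where
  "bvp_solution n \<kappa> y \<longleftrightarrow>
     y ` {0..1} \<subseteq> {0..1} \<and> y 0 = 0 \<and> y 1 = 1 \<and>
     (\<exists>y'. \<forall>x\<in>{0..1}.
        (y has_real_derivative y' x) (at x within {0..1}) \<and>
        (y' has_real_derivative \<kappa>\<^sup>2 * y x powr n) (at x within {0..1}))"

definition first_order_eq :: "real \<Rightarrow> real \<Rightarrow> real \<Rightarrow> (real \<Rightarrow> real) \<Rightarrow> bool" where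
  "first_order_eq n \<kappa> C y \<longleftrightarrow>
     (\<forall>x\<in>{0..1}.
        (y has_real_derivative \<kappa> * sqrt 2 * sqrt (y x powr (n + 1) / (n + 1) + C))
          (at x within {0..1}))"

text \<open>Lemma \<open>C_ex_well_defined\<close> below shows that the description is proper.\<close>

definition C_ex :: "real \<Rightarrow> real \<Rightarrow> (real \<Rightarrow> real) \<Rightarrow> real" where
  "C_ex n \<kappa> y = (THE C. C > 0 \<and> first_order_eq n \<kappa> C y)"

lemma nondecreasing_on_unit:
  fixes f f' :: "real \<Rightarrow> real"
  assumes d: "\<And>x. x \<in> {0..1} \<Longrightarrow> (f has_real_derivative f' x) (at x within {0..1})"
    and nonneg: "\<And>x. x \<in> {0..1} \<Longrightarrow> f' x \<ge> 0"
    and "0 \<le> a" "a \<le> b" "b \<le> 1"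
  shows "f a \<le> f b"
proof (rule DERIV_nonneg_imp_increasing_open[OF \<open>a \<le> b\<close>])
  fix x assume "a < x" "x < b"
  then have "x \<in> {0..1}" "x \<in> interior {0..1}"
    using assms(3-5) by (auto simp: interior_atLeastAtMost_real)
  then show "\<exists>D. DERIV f x :> D \<and> D \<ge> 0"
    using d nonneg at_within_interior by metis
next
  have "continuous_on {0..1} f"
    using d DERIV_continuous_on by blast
  then show "continuous_on {a..b} f"
    by (rule continuous_on_subset) (use assms in auto)
qed

lemma has_derivative_powr_nonneg:
  fixes p z :: real
  assumes "p > 1" "z \<ge> 0"
  shows "((\<lambda>z. z powr p) has_real_derivative p * z powr (p - 1)) (at z within {0..})"
proof (cases "z = 0")
  case True
  have "((\<lambda>y. y powr (p - 1)) \<longlongrightarrow> 0 powr (p - 1)) (at 0 within {0..})"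
    by (rule tendsto_powr') (use assms in \<open>auto simp: eventually_at_filter\<close>)
  moreover have "eventually (\<lambda>y. y powr (p - 1) = (y powr p - 0 powr p) / (y - 0)) (at 0 within {0..})"
    using assms by (auto simp: eventually_at_filter powr_diff)
  ultimately show ?thesis
    using True assms by (auto simp: has_field_derivative_iff elim: Lim_transform_eventually)
next
  case False
  then show ?thesis
    using assms by (intro has_field_derivative_at_within[OF has_real_derivative_powr]) simp
qed

lemma C_ex_well_defined:
  assumes n: "n > 1" and k: "\<kappa> > 0" and sol: "bvp_solution n \<kappa> y"
  shows "\<exists>!C. C > 0 \<and> first_order_eq n \<kappa> C y"
    and "C_ex n \<kappa> y > 0" and "first_order_eq n \<kappa> (C_ex n \<kappa> y) y"
proof -
  from sol obtain y' where
    y01: "\<And>x. x \<in> {0..1} \<Longrightarrow> 0 \<le> y x \<and> y x \<le> 1" and y0: "y 0 = 0" and y1: "y 1 = 1"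
    and d1: "\<And>x. x \<in> {0..1} \<Longrightarrow> (y has_real_derivative y' x) (at x within {0..1})"
    and d2: "\<And>x. x \<in> {0..1} \<Longrightarrow>
              (y' has_real_derivative \<kappa>\<^sup>2 * y x powr n) (at x within {0..1})"
    unfolding bvp_solution_def image_subset_iff by (auto simp: Ball_def)
  have y'mono: "y' 0 \<le> y' x" if "x \<in> {0..1}" for x
    by (rule nondecreasing_on_unit[OF d2]) (use that in auto)
  have y'0: "y' 0 \<ge> 0"
  proof -
    have "((\<lambda>x. (y x - y 0) / (x - 0)) \<longlongrightarrow> y' 0) (at 0 within {0..1})"
      using d1[of 0] by (simp add: has_field_derivative_iff)
    moreover have "eventually (\<lambda>x. 0 \<le> (y x - y 0) / (x - 0)) (at 0 within {0..1})"
      using y01 y0 by (auto simp: eventually_at_filter)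
    moreover have "at (0::real) within {0..1} \<noteq> bot"
      by (simp add: at_within_Icc_at_right)
    ultimately show ?thesis
      by (metis tendsto_lowerbound)
  qed
  have y'nonneg: "y' x \<ge> 0" if "x \<in> {0..1}" for x
    using y'mono[OF that] y'0 by linarith
  define E where "E x = (y' x)\<^sup>2 - 2 * \<kappa>\<^sup>2 / (n + 1) * y x powr (n + 1)" for x
  have dE: "(E has_real_derivative 0) (at x within {0..1})" if x: "x \<in> {0..1}" for x
  proof -
    have "((\<lambda>z. z powr (n + 1)) has_real_derivative (n + 1) * y x powr n) (at (y x) within {0..})"
      using has_derivative_powr_nonneg[of "n + 1" "y x"] n y01[OF x] by simp
    then have "((\<lambda>z. z powr (n + 1)) has_real_derivative (n + 1) * y x powr n)
                 (at (y x) within y ` {0..1})"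
      by (rule has_field_derivative_subset) (use y01 in auto)
    from DERIV_image_chain[OF this d1[OF x]]
    have P: "((\<lambda>x. y x powr (n + 1)) has_real_derivative (n + 1) * y x powr n * y' x)
            (at x within {0..1})"
      by (simp add: o_def)
    show ?thesis unfolding E_def
      by (rule derivative_eq_intros d2[OF x] P refl)+ (use n in \<open>simp add: field_simps\<close>)
  qed
  have E: "E x = (y' 0)\<^sup>2" if "x \<in> {0..1}" for x
  proof -
    obtain c where "\<forall>x\<in>{0..1}. E x = c"
      using has_field_derivative_zero_constant[of "{0..1::real}" E] dE by auto
    then have "E x = E 0" using that by simp
    then show ?thesis by (simp add: E_def y0)
  qed
  have energy: "(y' x)\<^sup>2 = 2 * \<kappa>\<^sup>2 * (y x powr (n + 1) / (n + 1) + (y' 0)\<^sup>2 / (2 * \<kappa>\<^sup>2))"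
    if "x \<in> {0..1}" for x
  proof -
    have "(y' x)\<^sup>2 = 2 * \<kappa>\<^sup>2 / (n + 1) * y x powr (n + 1) + (y' 0)\<^sup>2"
      using E[OF that] by (simp add: E_def)
    then show ?thesis using k by (simp add: distrib_left)
  qed
  have y'0pos: "y' 0 > 0"
  proof (rule ccontr)
    assume "\<not> y' 0 > 0"
    then have z: "y' 0 = 0" using y'0 by simp
    have le: "y' x \<le> 2 * \<kappa> * y x" if x: "x \<in> {0..1}" for x
    proof (rule power2_le_imp_le)
      have "y x powr (n + 1) \<le> y x powr 2"
        using y01[OF x] n by (intro powr_mono') auto
      also have "\<dots> = (y x)\<^sup>2"
        using y01[OF x] by (cases "y x = 0") auto
      finally have p: "y x powr (n + 1) \<le> (y x)\<^sup>2" .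
      have "y x powr (n + 1) / (n + 1) \<le> y x powr (n + 1)"
        using n by (simp add: divide_le_eq distrib_left)
      with p have "2 * \<kappa>\<^sup>2 * (y x powr (n + 1) / (n + 1)) \<le> 2 * \<kappa>\<^sup>2 * (y x)\<^sup>2"
        by (intro mult_left_mono) auto
      also have "\<dots> \<le> (2 * \<kappa> * y x)\<^sup>2"
        by (simp add: power_mult_distrib mult_right_mono)
      finally show "(y' x)\<^sup>2 \<le> (2 * \<kappa> * y x)\<^sup>2"
        using energy[OF x] z by simp
      show "0 \<le> 2 * \<kappa> * y x" using k y01[OF x] by simp
    qed
    define g where "g x = - (y x * exp (- 2 * \<kappa> * x))" for x
    have "g 0 \<le> g 1"
    proof (rule nondecreasing_on_unit
        [where f = g and a = 0 and b = 1 and f' = "\<lambda>x. (2 * \<kappa> * y x - y' x) * exp (- 2 * \<kappa> * x)"])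
      fix x :: real assume x: "x \<in> {0..1}"
      show "(g has_real_derivative (2 * \<kappa> * y x - y' x) * exp (- 2 * \<kappa> * x)) (at x within {0..1})"
        unfolding g_def
        by (auto intro!: derivative_eq_intros d1[OF x] simp: algebra_simps)
      show "0 \<le> (2 * \<kappa> * y x - y' x) * exp (- 2 * \<kappa> * x)"
        using le[OF x] by simp
    qed auto
    then show False by (simp add: g_def y0 y1)
  qed
  have foe: "first_order_eq n \<kappa> ((y' 0)\<^sup>2 / (2 * \<kappa>\<^sup>2)) y"
    unfolding first_order_eq_def
  proof
    fix x :: real assume x: "x \<in> {0..1}"
    have "y' x = sqrt ((y' x)\<^sup>2)" using y'nonneg[OF x] by simp
    also have "\<dots> = \<kappa> * sqrt 2 * sqrt (y x powr (n + 1) / (n + 1) + (y' 0)\<^sup>2 / (2 * \<kappa>\<^sup>2))"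
      unfolding energy[OF x] using k by (simp add: real_sqrt_mult)
    finally show "(y has_real_derivative
      \<kappa> * sqrt 2 * sqrt (y x powr (n + 1) / (n + 1) + (y' 0)\<^sup>2 / (2 * \<kappa>\<^sup>2))) (at x within {0..1})"
      using d1[OF x] by simp
  qed
  show ex1: "\<exists>!C. C > 0 \<and> first_order_eq n \<kappa> C y"
  proof (rule ex1I)
    show "(y' 0)\<^sup>2 / (2 * \<kappa>\<^sup>2) > 0 \<and> first_order_eq n \<kappa> ((y' 0)\<^sup>2 / (2 * \<kappa>\<^sup>2)) y"
      using foe y'0pos k by simp
  next
    fix C assume C: "C > 0 \<and> first_order_eq n \<kappa> C y"
    then have "(y has_real_derivative \<kappa> * sqrt 2 * sqrt C) (at 0 within {0..1})"
      unfolding first_order_eq_def by (force simp: y0)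
    moreover have "at (0::real) within {0..1} \<noteq> bot"
      by (simp add: at_within_Icc_at_right)
    ultimately have "y' 0 = \<kappa> * sqrt 2 * sqrt C"
      using d1[of 0] has_field_derivative_unique by fastforce
    then show "C = (y' 0)\<^sup>2 / (2 * \<kappa>\<^sup>2)"
      using C k by (simp add: power_mult_distrib)
  qed
  from theI'[OF ex1] show "C_ex n \<kappa> y > 0" and "first_order_eq n \<kappa> (C_ex n \<kappa> y) y"
    unfolding C_ex_def by auto
qed

text \<open>The point \<open>y\<^sup>-\<^sup>1(0.9)\<close> is interior to \<open>[0,1]\<close>, so the two-sided \<^const>\<open>deriv\<close> is
  the derivative meant here.\<close>

definition has_boundary_layer :: "(real \<Rightarrow> real) \<Rightarrow> bool" where
  "has_boundary_layer y \<longleftrightarrow> deriv y (the_inv_into {0..1} y (9/10)) > 50"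

definition kappa_bl :: "real \<Rightarrow> real" where
  "kappa_bl n = 36 * sqrt ((n + 1) / (9/10) powr (n + 1))"

definition y_plus :: "real \<Rightarrow> real \<Rightarrow> real \<Rightarrow> real" where
  "y_plus n \<kappa> x =
     (1 + \<kappa> * (n - 1) / sqrt (2 * (n + 1)) * (1 - x)) powr (- 2 / (n - 1))"

definition xi :: "real \<Rightarrow> real" where
  "xi n = (n - 1) / (n + 1)"

definition C_plus :: "real \<Rightarrow> real \<Rightarrow> real" where
  "C_plus n \<kappa> = 1/2 * (y_plus n \<kappa> (xi n) / (\<kappa> * xi n))\<^sup>2"

definition c_plus :: "real \<Rightarrow> real \<Rightarrow> real" where
  "c_plus n \<kappa> = ((n + 1) * C_plus n \<kappa>) powr (1 / (n + 1))"

definition y_bullet :: "real \<Rightarrow> real \<Rightarrow> real \<Rightarrow> real" where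
  "y_bullet n \<kappa> x =
     ((1 + c_plus n \<kappa>) powr (- (n - 1) / 2)
        + \<kappa> * (n - 1) / sqrt (2 * (n + 1)) * (1 - x)) powr (- 2 / (n - 1))
     - c_plus n \<kappa>"

definition lam :: "real \<Rightarrow> real \<Rightarrow> real" where
  "lam n \<kappa> = y_plus n \<kappa> 0 / (y_plus n \<kappa> 0 - y_bullet n \<kappa> 0)"

definition y_minus :: "real \<Rightarrow> real \<Rightarrow> real \<Rightarrow> real" where
  "y_minus n \<kappa> x = (1 - lam n \<kappa>) * y_plus n \<kappa> x + lam n \<kappa> * y_bullet n \<kappa> x"

definition C_minus :: "real \<Rightarrow> real \<Rightarrow> real" where
  "C_minus n \<kappa> = y_plus n \<kappa> 0 powr (n + 1) / (n + 1)"

end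

theory Submission
  imports Defs
begin

text \<open>
  Multiplying \<open>y'' = \<kappa>\<^sup>2 y\<^sup>n\<close> by \<open>y'\<close> and integrating gives \<open>y' = rate C y\<close>. For \<open>C = 0\<close> this is
  solved explicitly, which yields \<open>y\<^sub>+\<close> and \<open>y\<^sub>\<bullet> + c\<^sub>+\<close>. Dropping \<open>C > 0\<close> makes \<open>y\<^sub>+\<close> an upper
  envelope. Hence \<open>y\<^sub>+ - y\<close> is convex and has negative slope at \<open>1\<close>, so also at \<open>0\<close>, which
  is \<open>C\<^sub>- \<le> C\<close>; convexity of \<open>y\<close> gives \<open>y'(0) \<le> y(\<xi>) / \<xi> \<le> y\<^sub>+(\<xi>) / \<xi>\<close>, which is \<open>C \<le> C\<^sub>+\<close>.
  Then \<open>y\<^sub>\<bullet>(0) \<le> 0\<close>, so \<open>0 < \<lambda> \<le> 1\<close>, and by convexity of the power function \<open>y\<^sub>-\<close> is a subsolution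
  of the second-order equation; the maximum principle gives \<open>y\<^sub>- \<le> y\<close>.
\<close>

section \<open>Monotonicity, comparison and the maximum principle on [0,1]\<close>

lemma nondecreasing_subinterval:
  fixes f f' :: "real \<Rightarrow> real"
  assumes d: "\<And>x. x \<in> {0..1} \<Longrightarrow> (f has_real_derivative f' x) (at x within {0..1})"
    and nonneg: "\<And>x. a < x \<Longrightarrow> x < b \<Longrightarrow> f' x \<ge> 0"
    and ab: "0 \<le> a" "a \<le> b" "b \<le> 1"
  shows "f a \<le> f b"
proof (rule DERIV_nonneg_imp_increasing_open[OF \<open>a \<le> b\<close>])
  fix x assume x: "a < x" "x < b"
  then have "x \<in> {0..1}" "x \<in> interior {0..1}"
    using ab by (auto simp: interior_atLeastAtMost_real)
  then show "\<exists>D. DERIV f x :> D \<and> D \<ge> 0"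
    using d nonneg[OF x] at_within_interior by metis
next
  have "continuous_on {0..1} f"
    using d DERIV_continuous_on by blast
  then show "continuous_on {a..b} f"
    by (rule continuous_on_subset) (use ab in auto)
qed

lemma strict_mono_on_unit:
  fixes f f' :: "real \<Rightarrow> real"
  assumes d: "\<And>x. x \<in> {0..1} \<Longrightarrow> (f has_real_derivative f' x) (at x within {0..1})"
    and pos: "\<And>x. x \<in> {0..1} \<Longrightarrow> f' x > 0"
  shows "strict_mono_on {0..1} f"
proof (rule strict_mono_onI)
  fix a b :: real assume ab: "a \<in> {0..1}" "b \<in> {0..1}" "a < b"
  show "f a < f b"
  proof (rule DERIV_pos_imp_increasing_open[OF \<open>a < b\<close>])
    fix x assume x: "a < x" "x < b"
    then have "x \<in> {0..1}" "x \<in> interior {0..1}"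
      using ab by (auto simp: interior_atLeastAtMost_real)
    then show "\<exists>D. DERIV f x :> D \<and> D > 0"
      using d pos at_within_interior by metis
  next
    have "continuous_on {0..1} f"
      using d DERIV_continuous_on by blast
    then show "continuous_on {a..b} f"
      by (rule continuous_on_subset) (use ab in auto)
  qed
qed

lemma first_nonpos:
  fixes d :: "real \<Rightarrow> real"
  assumes "continuous_on {a..b} d" "a \<le> b" "d a > 0" "d b \<le> 0"
  obtains t where "a < t" "t \<le> b" "d t \<le> 0" "\<And>x. a \<le> x \<Longrightarrow> x < t \<Longrightarrow> d x > 0"
proof -
  define S where "S = {x \<in> {a..b}. d x \<le> 0}"
  have "S = {a..b} \<inter> d -` {..0}" by (auto simp: S_def)
  then have "closed S"
    using continuous_closed_preimage[OF assms(1), of "{..0}"] by simp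
  then have "compact ({a..b} \<inter> S)"
    by (intro compact_Int_closed) auto
  moreover have "{a..b} \<inter> S = S" by (auto simp: S_def)
  ultimately have "compact S" by simp
  moreover have "S \<noteq> {}" using assms by (auto simp: S_def)
  ultimately obtain t where t: "t \<in> S" "\<And>x. x \<in> S \<Longrightarrow> t \<le> x"
    by (meson compact_attains_inf)
  show thesis
  proof (rule that[of t])
    show "a < t" using t(1) assms(3) by (cases "a = t") (auto simp: S_def)
    show "t \<le> b" "d t \<le> 0" using t(1) by (auto simp: S_def)
    fix x assume "a \<le> x" "x < t"
    then show "d x > 0" using t(2)[of x] t(1) by (force simp: S_def)
  qed
qed

text \<open>Comparison argument: up to the first point where \<open>d\<close> fails to be positive,
  \<open>step\<close> makes \<open>d\<close> nondecreasing, so \<open>d\<close> is at least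
  \<open>d a > 0\<close> there too. The sign of \<open>d'\<close> at \<open>x\<close> may thus rely
  on \<open>d\<close> being positive all the way from \<open>a\<close> to \<open>x\<close>.\<close>

lemma positive_persists:
  fixes d d' :: "real \<Rightarrow> real"
  assumes d: "\<And>x. x \<in> {0..1} \<Longrightarrow> (d has_real_derivative d' x) (at x within {0..1})"
    and ab: "0 \<le> a" "a \<le> b" "b \<le> 1" and pos: "d a > 0"
    and step: "\<And>x. a < x \<Longrightarrow> x < b \<Longrightarrow> (\<And>z. a \<le> z \<Longrightarrow> z \<le> x \<Longrightarrow> d z > 0) \<Longrightarrow> d' x \<ge> 0"
  shows "d b > 0"
proof (rule ccontr)
  assume neg: "\<not> d b > 0"
  have "continuous_on {0..1} d"
    using d DERIV_continuous_on by blast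
  then have "continuous_on {a..b} d"
    by (rule continuous_on_subset) (use ab in auto)
  then obtain t where t: "a < t" "t \<le> b" "d t \<le> 0" "\<And>x. a \<le> x \<Longrightarrow> x < t \<Longrightarrow> d x > 0"
    using first_nonpos[of a b d] ab pos neg by (metis not_less)
  have "d a \<le> d t"
    by (rule nondecreasing_subinterval[OF d]) (use t ab in \<open>auto intro!: step\<close>)
  with t pos show False by linarith
qed

text \<open>At a positive interior maximum \<open>d'\<close> vanishes. As long as \<open>d\<close>
  stays positive to its right, \<open>d'\<close> is nondecreasing, hence nonnegative, so
  \<open>d\<close> remains positive up to 1, against \<open>d 1 \<le> 0\<close>.\<close>

lemma max_principle:
  fixes d d' d'' :: "real \<Rightarrow> real"
  assumes d: "\<And>x. x \<in> {0..1} \<Longrightarrow> (d has_real_derivative d' x) (at x within {0..1})"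
    and d2: "\<And>x. x \<in> {0..1} \<Longrightarrow> (d' has_real_derivative d'' x) (at x within {0..1})"
    and bd: "d 0 \<le> 0" "d 1 \<le> 0"
    and conv: "\<And>x. x \<in> {0..1} \<Longrightarrow> d x > 0 \<Longrightarrow> d'' x \<ge> 0"
    and x: "x \<in> {0..1}"
  shows "d x \<le> 0"
proof (rule ccontr)
  assume neg: "\<not> d x \<le> 0"
  have "continuous_on {0..1} d"
    using d DERIV_continuous_on by blast
  then obtain m where m: "m \<in> {0..1}" "\<And>z. z \<in> {0..1} \<Longrightarrow> d z \<le> d m"
    using continuous_attains_sup[of "{0..1::real}" d] by auto
  have dm: "d m > 0" using m(2)[OF x] neg by linarith
  have m01: "0 < m" "m < 1"
    using m(1) dm bd by (auto simp: less_le)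
  have "m \<in> interior {0..1}" using m01 by simp
  then have "DERIV d m :> d' m"
    using d[OF m(1)] at_within_interior by metis
  then have crit: "d' m = 0"
    by (rule DERIV_local_max[of _ _ _ "min m (1 - m)"]) (use m01 in \<open>auto intro!: m(2)\<close>)
  have "d 1 > 0"
  proof (rule positive_persists[OF d _ _ _ dm])
    fix x assume x: "m < x" "x < 1" and p: "\<And>z. m \<le> z \<Longrightarrow> z \<le> x \<Longrightarrow> d z > 0"
    have "d' m \<le> d' x"
      by (rule nondecreasing_subinterval[OF d2]) (use x m01 p conv in auto)
    then show "d' x \<ge> 0" using crit by simp
  qed (use m01 in auto)
  then show False using bd by simp
qed

text \<open>Split off one factor, \<open>z powr p = z * z powr (p - 1)\<close>, and enlarge both
  second factors to \<open>(u + v) powr (p - 1)\<close>.\<close>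

lemma powr_superadditive:
  fixes u v p :: real
  assumes "u \<ge> 0" "v \<ge> 0" "p \<ge> 1"
  shows "u powr p + v powr p \<le> (u + v) powr p"
proof -
  have *: "z powr p = z * z powr (p - 1)" if "z \<ge> 0" for z :: real
    using that by (cases "z = 0") (auto simp: powr_diff)
  have "u * u powr (p - 1) + v * v powr (p - 1)
      \<le> u * (u + v) powr (p - 1) + v * (u + v) powr (p - 1)"
    using assms by (intro add_mono mult_left_mono powr_mono2) auto
  then show ?thesis
    using assms by (simp add: * distrib_right)
qed

section \<open>The right-hand side of the first-order equation\<close>

definition rate :: "real \<Rightarrow> real \<Rightarrow> real \<Rightarrow> real \<Rightarrow> real" where
  "rate n \<kappa> C z = \<kappa> * sqrt 2 * sqrt (z powr (n + 1) / (n + 1) + C)"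

lemma rate_mono:
  assumes "n > 1" "\<kappa> > 0" "0 \<le> z" "z \<le> w" "C \<le> D"
  shows "rate n \<kappa> C z \<le> rate n \<kappa> D w"
  unfolding rate_def using assms
  by (intro mult_left_mono real_sqrt_le_mono add_mono divide_right_mono powr_mono2) auto

lemma rate_strict_mono:
  assumes "n > 1" "\<kappa> > 0" "0 \<le> z" "z < w"
  shows "rate n \<kappa> C z < rate n \<kappa> C w"
  unfolding rate_def using assms
  by (intro mult_strict_left_mono real_sqrt_less_mono add_strict_right_mono
      divide_strict_right_mono powr_less_mono2) auto

lemma rate_less:
  assumes "\<kappa> > 0" "C < D"
  shows "rate n \<kappa> C z < rate n \<kappa> D z"
  unfolding rate_def using assms
  by (intro mult_strict_left_mono real_sqrt_less_mono add_strict_left_mono) auto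

lemma rate_pos:
  assumes "n > 1" "\<kappa> > 0" "C \<ge> 0" "z > 0"
  shows "rate n \<kappa> C z > 0"
  unfolding rate_def using assms by (intro mult_pos_pos) (auto intro!: add_pos_nonneg)

text \<open>For \<open>C = 0\<close> the right-hand side is a pure power, so the equation can be
  solved by separation of variables.\<close>

lemma rate_0:
  assumes "n > 1" "z \<ge> 0"
  shows "rate n \<kappa> 0 z = \<kappa> * sqrt 2 / sqrt (n + 1) * z powr ((n + 1) / 2)"
  unfolding rate_def using assms by (simp add: real_sqrt_divide powr_half_sqrt_powr)

text \<open>The first-order equation implies the second-order one: the chain rule yields a factor
  \<open>1 / s\<close> that cancels the \<open>s\<close> inside \<open>rate\<close>.
  \<open>f x = 0\<close> is allowed, hence the one-sided derivative of \<open>powr\<close>;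
  \<open>pos\<close> keeps the argument of the root away from 0.\<close>

lemma rate_has_derivative:
  assumes n: "n > 1" and nonneg: "\<And>x. x \<in> S \<Longrightarrow> f x \<ge> 0" and x: "x \<in> S"
    and f: "(f has_real_derivative rate n \<kappa> C (f x)) (at x within S)"
    and pos: "f x powr (n + 1) / (n + 1) + C > 0"
  shows "((\<lambda>x. rate n \<kappa> C (f x)) has_real_derivative \<kappa>\<^sup>2 * f x powr n) (at x within S)"
proof -
  have "((\<lambda>z. z powr (n + 1)) has_real_derivative (n + 1) * f x powr n) (at (f x) within {0..})"
    using has_derivative_powr_nonneg[of "n + 1" "f x"] n nonneg[OF x] by simp
  then have "((\<lambda>z. z powr (n + 1)) has_real_derivative (n + 1) * f x powr n)
               (at (f x) within f ` S)"
    by (rule has_field_derivative_subset) (use nonneg in auto)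
  from DERIV_image_chain[OF this f]
  have P: "((\<lambda>x. f x powr (n + 1)) has_real_derivative
      (n + 1) * f x powr n * rate n \<kappa> C (f x)) (at x within S)"
    by (simp add: o_def)
  have Q: "((\<lambda>x. f x powr (n + 1) / (n + 1) + C) has_real_derivative
      f x powr n * rate n \<kappa> C (f x)) (at x within S)"
    using DERIV_add[OF DERIV_cdivide[OF P, of "n + 1"] DERIV_const[of C]] n by simp
  define s where "s = sqrt (f x powr (n + 1) / (n + 1) + C)"
  have s: "s > 0" using pos by (simp add: s_def)
  have "((\<lambda>x. rate n \<kappa> C (f x)) has_real_derivative
      \<kappa> * sqrt 2 * (inverse s / 2 * (f x powr n * rate n \<kappa> C (f x)))) (at x within S)"
    unfolding rate_def[of n \<kappa> C "f _"] s_def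
    using DERIV_chain2[OF DERIV_real_sqrt[OF pos] Q]
    by (intro DERIV_cmult) (simp add: rate_def)
  moreover have "\<kappa> * sqrt 2 * (inverse s / 2 * (f x powr n * rate n \<kappa> C (f x)))
      = \<kappa>\<^sup>2 * f x powr n"
  proof -
    have "rate n \<kappa> C (f x) = \<kappa> * sqrt 2 * s"
      by (simp add: rate_def s_def)
    moreover have "\<kappa> * sqrt 2 * (inverse s / 2 * (f x powr n * (\<kappa> * sqrt 2 * s)))
        = \<kappa>\<^sup>2 * f x powr n * (sqrt 2 * sqrt 2 / 2) * (inverse s * s)"
      by (simp only: power2_eq_square divide_inverse mult_ac)
    moreover have "sqrt 2 * sqrt 2 / 2 = (1::real)" "inverse s * s = 1"
      using s by auto
    ultimately show ?thesis by (simp only: mult_1_right)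
  qed
  ultimately show ?thesis by (simp only:)
qed

section \<open>Explicit envelopes, the case C = 0\<close>

text \<open>The constant speed at which \<open>f powr (- (n - 1) / 2)\<close> decreases along a
  positive solution of \<open>f' = rate n \<kappa> 0 f\<close>.\<close>

definition slope :: "real \<Rightarrow> real \<Rightarrow> real" where
  "slope n \<kappa> = \<kappa> * (n - 1) / sqrt (2 * (n + 1))"

lemma slope_eq: "slope n \<kappa> = (n - 1) / 2 * (\<kappa> * sqrt 2 / sqrt (n + 1))"
proof -
  have "1 / sqrt 2 = sqrt 2 / (2::real)"
    by (simp add: divide_simps)
  then have "\<kappa> * (n - 1) / sqrt (n + 1) * (1 / sqrt 2) = \<kappa> * (n - 1) / sqrt (n + 1) * (sqrt 2 / 2)"
    by (simp only:)
  then show ?thesis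
    by (simp only: slope_def real_sqrt_mult) (simp add: mult_ac)
qed

lemma slope_pos: "n > 1 \<Longrightarrow> \<kappa> > 0 \<Longrightarrow> slope n \<kappa> > 0"
  by (simp add: slope_def)

text \<open>The positive solutions of \<open>y' = rate n \<kappa> 0 y\<close>; \<open>b\<close> is the value of \<open>y powr (- (n - 1) / 2)\<close>
  at \<open>1\<close>.\<close>

definition env :: "real \<Rightarrow> real \<Rightarrow> real \<Rightarrow> real \<Rightarrow> real" where
  "env n \<kappa> b x = (b + slope n \<kappa> * (1 - x)) powr (- 2 / (n - 1))"

lemma env_base_pos:
  assumes "n > 1" "\<kappa> > 0" "b > 0" "x \<le> 1"
  shows "b + slope n \<kappa> * (1 - x) > 0"
  using assms slope_pos[of n \<kappa>] by (simp add: add_pos_nonneg)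

lemma env_pos:
  assumes "n > 1" "\<kappa> > 0" "b > 0" "x \<le> 1"
  shows "env n \<kappa> b x > 0"
  using env_base_pos[OF assms] by (simp add: env_def)

lemma env_antimono:
  assumes "n > 1" "\<kappa> > 0" "0 < b" "b < c" "x \<le> 1"
  shows "env n \<kappa> c x < env n \<kappa> b x"
  using env_base_pos[of n \<kappa> b x] assms
  by (auto simp: env_def intro!: powr_less_mono2_neg)

lemma env_deriv:
  assumes n: "n > 1" and k: "\<kappa> > 0" and b: "b > 0" and x: "x \<le> 1"
  shows "(env n \<kappa> b has_real_derivative rate n \<kappa> 0 (env n \<kappa> b x)) (at x)"
proof -
  define B where "B = b + slope n \<kappa> * (1 - x)"
  have B: "B > 0" using env_base_pos[OF assms] by (simp add: B_def)
  have "(env n \<kappa> b has_real_derivative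
      (- slope n \<kappa>) * (- 2 / (n - 1)) * B powr (- 2 / (n - 1) - 1)) (at x)"
    unfolding env_def B_def
    by (rule derivative_eq_intros refl | use B in \<open>simp add: B_def powr_diff field_simps\<close>)+
  moreover have "(- slope n \<kappa>) * (- 2 / (n - 1)) = \<kappa> * sqrt 2 / sqrt (n + 1)"
    unfolding slope_eq using n by (simp add: divide_simps)
  \<comment> \<open>Both exponents of \<open>B\<close> equal
    \<open>- (n + 1) / (n - 1)\<close>.\<close>
  moreover have "B powr (- 2 / (n - 1) - 1) = env n \<kappa> b x powr ((n + 1) / 2)"
    using n unfolding env_def B_def[symmetric] powr_powr
    by (intro arg_cong[of _ _ "(powr) B"]) (simp add: field_simps)
  moreover have "rate n \<kappa> 0 (env n \<kappa> b x)
      = \<kappa> * sqrt 2 / sqrt (n + 1) * env n \<kappa> b x powr ((n + 1) / 2)"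
    by (rule rate_0[OF n]) (simp add: env_def)
  ultimately show ?thesis by (simp only:)
qed

lemma env_deriv2:
  assumes n: "n > 1" and k: "\<kappa> > 0" and b: "b > 0" and x: "x \<le> 1"
  shows "((\<lambda>x. rate n \<kappa> 0 (env n \<kappa> b x)) has_real_derivative \<kappa>\<^sup>2 * env n \<kappa> b x powr n) (at x)"
proof (rule rate_has_derivative[where S = UNIV])
  show "0 \<le> env n \<kappa> b x" for x by (simp add: env_def)
  show "0 < env n \<kappa> b x powr (n + 1) / (n + 1) + 0"
    using n env_pos[OF assms] by simp
qed (use n env_deriv[OF assms] in auto)

text \<open>The two exponents are reciprocal; so \<open>b = z powr (- (n - 1) / 2)\<close> gives the
  envelope the value \<open>z\<close> at 1.\<close>

lemma powr_eq_env:
  fixes n z :: real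
  assumes "n > 1" "z > 0"
  shows "(z powr (- (n - 1) / 2)) powr (- 2 / (n - 1)) = z"
proof -
  have "(- (n - 1) / 2) * (- 2 / (n - 1)) = 1"
    using assms by (simp add: divide_simps)
  then show ?thesis
    using assms by (simp only: powr_powr) simp
qed

lemma y_plus_env: "y_plus n \<kappa> = env n \<kappa> 1"
  by (simp add: fun_eq_iff y_plus_def env_def slope_def)

lemma y_bullet_env:
  "y_bullet n \<kappa> x = env n \<kappa> ((1 + c_plus n \<kappa>) powr (- (n - 1) / 2)) x - c_plus n \<kappa>"
  by (simp add: y_bullet_def env_def slope_def)

section \<open>The solution and its derivatives\<close>

locale bvp =
  fixes n \<kappa> :: real and y :: "real \<Rightarrow> real"
  assumes n: "n > 1" and k: "\<kappa> > 0" and sol: "bvp_solution n \<kappa> y"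
begin

abbreviation "C \<equiv> C_ex n \<kappa> y"
abbreviation "c \<equiv> c_plus n \<kappa>"
abbreviation "yp \<equiv> env n \<kappa> 1"
text \<open>Chosen so that \<open>yb 1 = 1 + c\<close>, i.e. \<open>yb - c\<close> takes the
  boundary value 1.\<close>

definition "b = (1 + c) powr (- (n - 1) / 2)"
abbreviation "yb \<equiv> env n \<kappa> b"

lemma C_pos: "C > 0"
  using C_ex_well_defined(2)[OF n k sol] .

lemma y0: "y 0 = 0" and y1: "y 1 = 1"
  using sol by (auto simp: bvp_solution_def)

lemma y_nonneg: "x \<in> {0..1} \<Longrightarrow> y x \<ge> 0"
  using sol by (auto simp: bvp_solution_def image_subset_iff)

lemma y_deriv: "x \<in> {0..1} \<Longrightarrow> (y has_real_derivative rate n \<kappa> C (y x)) (at x within {0..1})"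
  using C_ex_well_defined(3)[OF n k sol] by (simp add: first_order_eq_def rate_def)

lemma y_continuous: "continuous_on {0..1} y"
  by (rule DERIV_continuous_on[OF y_deriv])

lemma y_deriv2:
  assumes "x \<in> {0..1}"
  shows "((\<lambda>x. rate n \<kappa> C (y x)) has_real_derivative \<kappa>\<^sup>2 * y x powr n) (at x within {0..1})"
  by (rule rate_has_derivative[OF n y_nonneg assms y_deriv[OF assms]])
     (use C_pos n in \<open>auto intro!: add_nonneg_pos\<close>)

lemma y_strict_mono: "strict_mono_on {0..1} y"
proof (rule strict_mono_on_unit[OF y_deriv])
  show "rate n \<kappa> C (y x) > 0" for x
    using n k C_pos unfolding rate_def by (auto intro!: mult_pos_pos add_nonneg_pos)
qed

lemma y_pos: "0 < x \<Longrightarrow> x \<le> 1 \<Longrightarrow> y x > 0"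
  using strict_mono_onD[OF y_strict_mono, of 0 x] y0 by simp

section \<open>Boundary layer\<close>

text \<open>At the point of value 9/10 the slope of \<open>y\<close> is
  \<open>rate n \<kappa> C (9/10)\<close>, which exceeds its value for constant 0;
  \<open>kappa_bl\<close> is scaled to make the latter at least \<open>36 * sqrt 2\<close>.\<close>

lemma boundary_layer:
  assumes "\<kappa> \<ge> kappa_bl n"
  shows "has_boundary_layer y"
proof -
  have "\<exists>x\<ge>0. x \<le> 1 \<and> y x = 9/10"
    by (rule IVT') (simp_all add: y0 y1 y_continuous)
  then obtain x where x: "0 \<le> x" "x \<le> 1" "y x = 9/10"
    by blast
  have inv: "the_inv_into {0..1} y (9/10) = x"
    using the_inv_into_f_f[OF strict_mono_on_imp_inj_on[OF y_strict_mono], of x] x by simp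
  have "x \<noteq> 0" "x \<noteq> 1" using x y0 y1 by auto
  then have "x \<in> interior {0..1}" using x by simp
  then have "DERIV y x :> rate n \<kappa> C (9/10)"
    using y_deriv[of x] x at_within_interior[of x "{0..1}"] by simp
  then have D: "deriv y x = rate n \<kappa> C (9/10)" by (rule DERIV_imp_deriv)
  define r :: real where "r = (9/10) powr (n + 1) / (n + 1)"
  have r: "r > 0" using n by (simp add: r_def)
  have "kappa_bl n * sqrt r = 36"
  proof -
    have "(n + 1) / (9/10) powr (n + 1) * r = 1" using n by (simp add: r_def)
    then have "sqrt ((n + 1) / (9/10) powr (n + 1)) * sqrt r = 1"
      by (simp only: real_sqrt_mult[symmetric] real_sqrt_one)
    then show ?thesis by (simp only: kappa_bl_def mult.assoc mult_1_right)
  qed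
  then have "36 \<le> \<kappa> * sqrt r"
    using mult_right_mono[OF assms, of "sqrt r"] r by simp
  then have "sqrt 2 * 36 \<le> sqrt 2 * (\<kappa> * sqrt r)"
    by (rule mult_left_mono) simp
  \<comment> \<open>The reason for the constant 36: \<open>36 * sqrt 2\<close> is just above
    50.\<close>
  moreover have "50 / 36 < sqrt (2::real)"
    by (rule real_less_rsqrt) (simp add: power2_eq_square)
  ultimately have "50 < sqrt 2 * (\<kappa> * sqrt r)"
    by linarith
  also have "\<dots> = rate n \<kappa> 0 (9/10)" by (simp add: rate_def r_def)
  also have "\<dots> < rate n \<kappa> C (9/10)" using rate_less[OF k C_pos] .
  finally show ?thesis by (simp add: has_boundary_layer_def inv D)
qed

section \<open>Upper envelope\<close>

text \<open>In terms of \<open>w = y powr (- (n - 1) / 2)\<close> the inequality \<open>y' \<ge> rate 0 y\<close> is linear: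
  \<open>w' \<le> - slope\<close>.\<close>

lemma upper_envelope:
  assumes x: "x \<in> {0..1}"
  shows "y x \<le> yp x"
\<comment> \<open>The substitution \<open>w\<close> fails at 0: \<open>y 0 = 0\<close>, and 0 to a
  negative power is 0 by convention rather than infinite.\<close>
proof (cases "x = 0")
  case True
  then show ?thesis by (simp add: y0 env_def)
next
  case False
  with x have x0: "0 < x" "x \<le> 1" by auto
  define w where "w z = y z powr (- (n - 1) / 2)" for z
  have "w x - slope n \<kappa> * (1 - x) \<ge> w 1 - slope n \<kappa> * (1 - 1)"
  proof (rule DERIV_nonpos_imp_decreasing_open[OF x0(2)])
    fix z assume z: "x < z" "z < 1"
    have "z \<in> {0..1}" "z \<in> interior {0..1}" using z x0 by auto
    then have dy: "DERIV y z :> rate n \<kappa> C (y z)"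
      using y_deriv at_within_interior by metis
    have yz: "y z > 0" using y_pos z x0 by simp
    have "DERIV (\<lambda>z. w z - slope n \<kappa> * (1 - z)) z :>
        (- (n - 1) / 2) * y z powr (- (n - 1) / 2 - 1) * rate n \<kappa> C (y z) + slope n \<kappa>"
      unfolding w_def
      by (rule derivative_eq_intros dy refl | use yz in \<open>simp add: powr_diff field_simps\<close>)+
    \<comment> \<open>\<open>slope\<close> is what \<open>- w'\<close> would be for constant 0; the
      true constant \<open>C > 0\<close> only makes \<open>w\<close> fall faster.\<close>
    moreover have "slope n \<kappa> = (n - 1) / 2 * y z powr (- (n - 1) / 2 - 1) * rate n \<kappa> 0 (y z)"
    proof -
      have "y z powr (- (n - 1) / 2 - 1) * y z powr ((n + 1) / 2) = 1"
        using yz by (simp add: powr_add[symmetric] field_simps)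
      then show ?thesis
        using n yz by (simp add: rate_0 slope_eq)
    qed
    moreover have "(n - 1) / 2 * y z powr (- (n - 1) / 2 - 1) * rate n \<kappa> 0 (y z)
        \<le> (n - 1) / 2 * y z powr (- (n - 1) / 2 - 1) * rate n \<kappa> C (y z)"
      using n rate_less[OF k C_pos, of n "y z"] by (intro mult_left_mono) auto
    ultimately show "\<exists>D. DERIV (\<lambda>z. w z - slope n \<kappa> * (1 - z)) z :> D \<and> D \<le> 0"
      by (intro exI conjI) (assumption, simp add: field_simps)
  next
    have "continuous_on {x..1} y"
      by (rule continuous_on_subset[OF y_continuous]) (use x in auto)
    moreover have "y z \<noteq> 0" if "z \<in> {x..1}" for z
      using y_pos[of z] that x0 by simp
    ultimately show "continuous_on {x..1} (\<lambda>z. w z - slope n \<kappa> * (1 - z))"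
      unfolding w_def by (intro continuous_intros) auto
  qed
  then have "1 + slope n \<kappa> * (1 - x) \<le> w x" by (simp add: w_def y1)
  then have "w x powr (- 2 / (n - 1)) \<le> yp x"
    unfolding env_def using n env_base_pos[OF n k, of 1 x] x0
    by (intro powr_mono2') auto
  then show ?thesis
    using powr_eq_env[OF n y_pos[OF x0]] by (simp add: w_def)
qed

section \<open>Bounds for the constant C\<close>

lemma xi01: "0 < xi n" "xi n < 1"
  using n by (auto simp: xi_def)

lemma C_le_C_plus: "C \<le> C_plus n \<kappa>"
proof -
  \<comment> \<open>The convex \<open>y\<close> lies above its tangent at 0. Any point of (0,1]
    would bound that tangent's slope; \<open>xi n\<close> is the limit for large
    \<open>\<kappa>\<close> of the point minimizing \<open>yp x / x\<close>.\<close>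
  have "y 0 - rate n \<kappa> C 0 * 0 \<le> y (xi n) - rate n \<kappa> C 0 * xi n"
  proof (rule nondecreasing_subinterval[where f = "\<lambda>x. y x - rate n \<kappa> C 0 * x"
        and f' = "\<lambda>x. rate n \<kappa> C (y x) - rate n \<kappa> C 0"])
    fix x :: real assume x: "x \<in> {0..1}"
    show "((\<lambda>x. y x - rate n \<kappa> C 0 * x) has_real_derivative rate n \<kappa> C (y x) - rate n \<kappa> C 0)
        (at x within {0..1})"
      by (auto intro!: derivative_eq_intros y_deriv[OF x])
  next
    fix x assume "0 < x" "x < xi n"
    then show "0 \<le> rate n \<kappa> C (y x) - rate n \<kappa> C 0"
      using rate_mono[OF n k, of 0 "y x" C C] y_nonneg[of x] xi01 by simp
  qed (use xi01 in auto)
  also have "y (xi n) \<le> yp (xi n)"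
    using upper_envelope xi01 by simp
  finally have "rate n \<kappa> C 0 * xi n \<le> yp (xi n)" by (simp add: y0)
  then have "sqrt 2 * sqrt C \<le> yp (xi n) / (\<kappa> * xi n)"
    using k xi01 by (simp add: rate_def field_simps)
  then have "(sqrt 2 * sqrt C)\<^sup>2 \<le> (yp (xi n) / (\<kappa> * xi n))\<^sup>2"
    using C_pos by (intro power_mono) auto
  then show ?thesis
    using C_pos by (simp add: C_plus_def y_plus_env power_mult_distrib)
qed

lemma C_minus_le_C: "C_minus n \<kappa> \<le> C"
proof -
  have "rate n \<kappa> 0 (yp 0) - rate n \<kappa> C (y 0) \<le> rate n \<kappa> 0 (yp 1) - rate n \<kappa> C (y 1)"
  proof (rule nondecreasing_subinterval[where f = "\<lambda>x. rate n \<kappa> 0 (yp x) - rate n \<kappa> C (y x)"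
        and f' = "\<lambda>x. \<kappa>\<^sup>2 * yp x powr n - \<kappa>\<^sup>2 * y x powr n"])
    fix x :: real assume x: "x \<in> {0..1}"
    then show "((\<lambda>x. rate n \<kappa> 0 (yp x) - rate n \<kappa> C (y x)) has_real_derivative
        \<kappa>\<^sup>2 * yp x powr n - \<kappa>\<^sup>2 * y x powr n) (at x within {0..1})"
      using has_field_derivative_at_within[OF env_deriv2[OF n k, of 1 x]]
      by (intro DERIV_diff y_deriv2) auto
  next
    fix x :: real assume "0 < x" "x < 1"
    then show "0 \<le> \<kappa>\<^sup>2 * yp x powr n - \<kappa>\<^sup>2 * y x powr n"
      using n upper_envelope[of x] y_nonneg[of x]
      by (auto intro!: mult_left_mono powr_mono2)
  qed auto
  \<comment> \<open>Both functions equal 1 at 1, so their slopes there differ only through the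
    constants 0 and \<open>C\<close>.\<close>
  also have "\<dots> \<le> 0"
    using rate_less[OF k C_pos, of n 1] by (simp add: env_def y1)
  finally have "rate n \<kappa> 0 (yp 0) \<le> rate n \<kappa> C 0" by (simp add: y0)
  then show ?thesis
    using k by (simp add: rate_def C_minus_def y_plus_env)
qed

section \<open>The shifted envelope\<close>

lemma C_plus_pos: "C_plus n \<kappa> > 0"
  using C_pos C_le_C_plus by linarith

lemma c_pos: "c > 0"
  using C_plus_pos n by (simp add: c_plus_def)

text \<open>The purpose of \<open>c\<close>: the constant-free equation at height \<open>c\<close>
  has the same rate as the equation with constant \<open>C_plus n \<kappa>\<close> at height
  0.\<close>

lemma c_powr: "c powr (n + 1) / (n + 1) = C_plus n \<kappa>"
  using C_plus_pos n by (simp add: c_plus_def powr_powr)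

lemma b_01: "0 < b" "b < 1"
  using c_pos n by (auto simp: b_def intro!: powr_less_one)

lemma yb_1: "yb 1 = 1 + c"
  unfolding env_def b_def using powr_eq_env[OF n, of "1 + c"] c_pos by simp

lemma yb_gt: "x \<le> 1 \<Longrightarrow> yp x < yb x"
  using env_antimono[OF n k b_01] .

lemma yp_pos: "x \<le> 1 \<Longrightarrow> yp x > 0"
  using env_pos[OF n k] by simp

text \<open>The envelopes are differentiable across the end points, so \<open>S\<close> is left
  free: the comparisons take \<open>{0..1}\<close>, the convexity criterion needs two-sided
  derivatives.\<close>

lemma unit_derivs:
  assumes "x \<in> {0..1}"
  shows "(yp has_real_derivative rate n \<kappa> 0 (yp x)) (at x within S)"
    "(yb has_real_derivative rate n \<kappa> 0 (yb x)) (at x within S)"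
    "((\<lambda>x. rate n \<kappa> 0 (yp x)) has_real_derivative \<kappa>\<^sup>2 * yp x powr n) (at x within S)"
    "((\<lambda>x. rate n \<kappa> 0 (yb x)) has_real_derivative \<kappa>\<^sup>2 * yb x powr n) (at x within S)"
  using assms b_01
  by (auto intro!: env_deriv[THEN has_field_derivative_at_within]
      env_deriv2[THEN has_field_derivative_at_within] n k)

text \<open>Superadditivity of \<open>z powr (n + 1)\<close> makes \<open>yb - c\<close> grow at least as fast as a solution with
  constant \<open>C_plus\<close>; were it positive at \<open>0\<close>, it could not meet \<open>y\<close> at \<open>1\<close>.\<close>

lemma yb_0_le: "yb 0 \<le> c"
proof (rule ccontr)
  assume "\<not> yb 0 \<le> c"
  then have pos: "yb 0 - c - y 0 > 0" by (simp add: y0)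
  have "yb 1 - c - y 1 > 0"
  proof (rule positive_persists[where d = "\<lambda>x. yb x - c - y x"
        and d' = "\<lambda>x. rate n \<kappa> 0 (yb x) - rate n \<kappa> C (y x)", OF _ _ _ _ pos])
    fix x :: real assume x: "x \<in> {0..1}"
    show "((\<lambda>x. yb x - c - y x) has_real_derivative rate n \<kappa> 0 (yb x) - rate n \<kappa> C (y x))
        (at x within {0..1})"
      by (auto intro!: derivative_eq_intros unit_derivs y_deriv x)
  next
    fix x :: real assume x: "0 < x" "x < 1"
      and p: "\<And>z. 0 \<le> z \<Longrightarrow> z \<le> x \<Longrightarrow> yb z - c - y z > 0"
    define u where "u = yb x - c"
    have u: "y x \<le> u" using p[of x] x by (simp add: u_def)
    have y: "y x \<ge> 0" using y_nonneg x by simp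
    have "rate n \<kappa> C (y x) \<le> rate n \<kappa> (C_plus n \<kappa>) u"
      using rate_mono[OF n k y u C_le_C_plus] .
    also have "\<dots> \<le> rate n \<kappa> 0 (u + c)"
    proof -
      have "u powr (n + 1) + c powr (n + 1) \<le> (u + c) powr (n + 1)"
        by (rule powr_superadditive) (use u y c_pos n in auto)
      then have "u powr (n + 1) / (n + 1) + C_plus n \<kappa> \<le> (u + c) powr (n + 1) / (n + 1)"
        unfolding c_powr[symmetric] add_divide_distrib[symmetric]
        using n by (intro divide_right_mono) auto
      then show ?thesis
        unfolding rate_def using k by (intro mult_left_mono real_sqrt_le_mono) auto
    qed
    finally show "0 \<le> rate n \<kappa> 0 (yb x) - rate n \<kappa> C (y x)" by (simp add: u_def)
  qed auto
  \<comment> \<open>By the choice of \<open>b\<close>, both \<open>yb - c\<close> and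
    \<open>y\<close> equal 1 at 1.\<close>
  then show False by (simp add: yb_1 y1)
qed

section \<open>The lower envelope\<close>

abbreviation "l \<equiv> lam n \<kappa>"

lemma y_bullet_b: "y_bullet n \<kappa> x = yb x - c"
  by (simp add: y_bullet_env b_def)

lemma y_plus_bullet_0: "y_plus n \<kappa> 0 - y_bullet n \<kappa> 0 > 0"
  using yp_pos[of 0] yb_0_le by (simp add: y_plus_env y_bullet_b)

text \<open>This makes \<open>y_minus\<close> a convex combination; \<open>l \<le> 1\<close> amounts
  to \<open>yb 0 \<le> c\<close>.\<close>

lemma lam01: "0 < l" "l \<le> 1"
  using y_plus_bullet_0 yp_pos[of 0] yb_0_le
  by (auto simp: lam_def y_plus_env y_bullet_b divide_le_eq_1)

lemma y_minus_eq: "y_minus n \<kappa> = (\<lambda>x. (1 - l) * yp x + l * (yb x - c))"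
  by (simp add: fun_eq_iff y_minus_def y_plus_env y_bullet_b)

lemma y_minus_0: "y_minus n \<kappa> 0 = 0"
  using y_plus_bullet_0 by (simp add: y_minus_def lam_def field_simps)

lemma y_minus_1: "y_minus n \<kappa> 1 = 1"
  unfolding y_minus_eq yb_1 by (simp add: env_def)

lemma y_minus_deriv:
  assumes "x \<in> {0..1}"
  shows "(y_minus n \<kappa> has_real_derivative (1 - l) * rate n \<kappa> 0 (yp x) + l * rate n \<kappa> 0 (yb x))
    (at x within S)"
  unfolding y_minus_eq
  by (auto intro!: derivative_eq_intros unit_derivs assms)

lemma y_minus_deriv2:
  assumes "x \<in> {0..1}"
  shows "((\<lambda>x. (1 - l) * rate n \<kappa> 0 (yp x) + l * rate n \<kappa> 0 (yb x)) has_real_derivative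
    \<kappa>\<^sup>2 * ((1 - l) * yp x powr n + l * yb x powr n)) (at x within S)"
  by (auto intro!: derivative_eq_intros unit_derivs assms simp: algebra_simps)

lemma y_minus_strict_mono: "strict_mono_on {0..1} (y_minus n \<kappa>)"
proof (rule strict_mono_on_unit[OF y_minus_deriv])
  fix x :: real assume "x \<in> {0..1}"
  then have "rate n \<kappa> 0 (yp x) > 0" "rate n \<kappa> 0 (yb x) > 0"
    using yp_pos[of x] yb_gt[of x] by (auto intro!: rate_pos n k)
  \<comment> \<open>Since \<open>l = 1\<close> is possible, strict positivity must come from the
    second summand.\<close>
  then show "0 < (1 - l) * rate n \<kappa> 0 (yp x) + l * rate n \<kappa> 0 (yb x)"
    using lam01 by (intro add_nonneg_pos mult_pos_pos mult_nonneg_nonneg) auto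
qed

lemma y_minus_pos: "x \<in> {0<..1} \<Longrightarrow> y_minus n \<kappa> x > 0"
  using strict_mono_onD[OF y_minus_strict_mono, of 0 x] y_minus_0 by simp

lemma y_minus_convex: "convex_on {0..1} (y_minus n \<kappa>)"
  by (rule f''_ge0_imp_convex[OF _ y_minus_deriv y_minus_deriv2]) (use lam01 in auto)

text \<open>The difference \<open>y_plus - y_minus\<close> is \<open>l * (yp - yb + c)\<close>, and
  \<open>yb\<close>, lying above \<open>yp\<close>, grows faster because \<open>rate\<close> is
  increasing.\<close>

lemma y_diff_antimono: "strict_antimono_on {0..1} (\<lambda>x. y_plus n \<kappa> x - y_minus n \<kappa> x)"
proof -
  have "strict_mono_on {0..1} (\<lambda>x. y_minus n \<kappa> x - y_plus n \<kappa> x)"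
  proof (rule strict_mono_on_unit)
    fix x :: real assume x: "x \<in> {0..1}"
    show "((\<lambda>x. y_minus n \<kappa> x - y_plus n \<kappa> x) has_real_derivative
        l * (rate n \<kappa> 0 (yb x) - rate n \<kappa> 0 (yp x))) (at x within {0..1})"
      unfolding y_plus_env
      by (auto intro!: derivative_eq_intros unit_derivs y_minus_deriv x simp: algebra_simps)
    show "0 < l * (rate n \<kappa> 0 (yb x) - rate n \<kappa> 0 (yp x))"
      using x lam01 yb_gt[of x] yp_pos[of x] rate_strict_mono[OF n k, of "yp x" "yb x" 0] by simp
  qed
  then show ?thesis
    by (force simp: monotone_on_def)
qed

text \<open>Maximum principle for \<open>y_minus - y\<close>: it vanishes at both ends, and wherever
  it is positive its second derivative is nonnegative.\<close>

lemma lower_envelope: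
  assumes x: "x \<in> {0..1}"
  shows "y_minus n \<kappa> x \<le> y x"
proof -
  have "y_minus n \<kappa> x - y x \<le> 0"
  proof (rule max_principle[OF DERIV_diff[OF y_minus_deriv y_deriv]
        DERIV_diff[OF y_minus_deriv2 y_deriv2] _ _ _ x])
    fix x :: real assume x: "x \<in> {0..1}" and gt: "0 < y_minus n \<kappa> x - y x"
    have p: "yp x > 0" "yb x > 0" using yp_pos[of x] yb_gt[of x] x by auto
    have "y x powr n \<le> y_minus n \<kappa> x powr n"
      using gt y_nonneg[OF x] n by (intro powr_mono2) auto
    \<comment> \<open>Dropping the shift \<open>- l * c\<close> only enlarges the base; Jensen's
      inequality for the convex power then gives \<open>y_minus''\<close> up to the factor
      \<open>\<kappa>\<^sup>2\<close>.\<close>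
    also have "\<dots> \<le> ((1 - l) * yp x + l * yb x) powr n"
      using gt y_nonneg[OF x] n lam01 c_pos
      by (intro powr_mono2) (auto simp: y_minus_eq algebra_simps)
    also have "\<dots> \<le> (1 - l) * yp x powr n + l * yb x powr n"
      using convex_onD[OF powr_convex[of n], of l "yp x" "yb x"] n lam01 p by simp
    finally show "0 \<le> \<kappa>\<^sup>2 * ((1 - l) * yp x powr n + l * yb x powr n) - \<kappa>\<^sup>2 * y x powr n"
      by (simp add: mult_left_mono)
  qed (auto simp: y_minus_0 y_minus_1 y0 y1)
  then show ?thesis by simp
qed

section \<open>Closed forms of the constants\<close>

lemma C_plus_formula:
  "C_plus n \<kappa> = 1 / (2 * \<kappa>\<^sup>2 * (xi n)\<^sup>2) *
     (1 + sqrt 2 * (n - 1) * \<kappa> / (n + 1) powr (3/2)) powr (- 4 / (n - 1))"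
proof -
  have "(n + 1) powr (3/2) = (n + 1) powr 1 * (n + 1) powr (1/2)"
    by (simp only: powr_add[symmetric]) simp
  then have 32: "(n + 1) powr (3/2) = (n + 1) * sqrt (n + 1)"
    using n by (simp add: powr_half_sqrt)
  have xi: "1 - xi n = 2 / (n + 1)"
    using n by (simp add: xi_def field_simps)
  \<comment> \<open>The power 3/2 combines \<open>sqrt (n + 1)\<close> from \<open>slope\<close>
    with \<open>n + 1\<close> from \<open>1 - xi n\<close>.\<close>
  have "slope n \<kappa> * (1 - xi n) = sqrt 2 * (n - 1) * \<kappa> / (n + 1) powr (3/2)"
    unfolding 32 xi slope_eq by (simp add: mult_ac)
  moreover have "- 2 / (n - 1) + - 2 / (n - 1) = - 4 / (n - 1)"
    by simp
  ultimately have "(yp (xi n))\<^sup>2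
      = (1 + sqrt 2 * (n - 1) * \<kappa> / (n + 1) powr (3/2)) powr (- 4 / (n - 1))"
    by (simp only: env_def power2_eq_square powr_add[symmetric])
  then show ?thesis
    by (simp add: C_plus_def y_plus_env power_divide power_mult_distrib)
qed

lemma C_minus_formula:
  "C_minus n \<kappa> = 1 / (n + 1) *
     (1 + \<kappa> * (n - 1) / sqrt (2 * (n + 1))) powr (- 2 * (n + 1) / (n - 1))"
proof -
  have "(- 2 / (n - 1)) * (n + 1) = - 2 * (n + 1) / (n - 1)"
    by (simp only: times_divide_eq_left)
  then show ?thesis
    by (simp only: C_minus_def y_plus_def powr_powr) simp
qed

end

theorem proposition2p1:
  fixes n \<kappa> :: real and y :: "real \<Rightarrow> real"
  assumes "n > 1" and "\<kappa> > 0" and "bvp_solution n \<kappa> y"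
  shows
    "(\<kappa> \<ge> kappa_bl n \<longrightarrow> has_boundary_layer y) \<and>
     (\<forall>x\<in>{0..1}. y x \<le> y_plus n \<kappa> x) \<and>
     (C_plus n \<kappa> = 1 / (2 * \<kappa>\<^sup>2 * (xi n)\<^sup>2) *
          (1 + sqrt 2 * (n - 1) * \<kappa> / (n + 1) powr (3/2)) powr (- 4 / (n - 1)) \<and>
      y_plus n \<kappa> 0 - y_bullet n \<kappa> 0 \<noteq> 0 \<and>
      y_minus n \<kappa> 0 = 0 \<and> y_minus n \<kappa> 1 = 1 \<and>
      strict_mono_on {0..1} (y_minus n \<kappa>) \<and>
      convex_on {0..1} (y_minus n \<kappa>) \<and>
      (\<forall>x\<in>{0<..1}. y_minus n \<kappa> x > 0) \<and>
      strict_antimono_on {0..1} (\<lambda>x. y_plus n \<kappa> x - y_minus n \<kappa> x) \<and>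
      (\<forall>x\<in>{0..1}. y_minus n \<kappa> x \<le> y x)) \<and>
     (C_minus n \<kappa> = 1 / (n + 1) *
          (1 + \<kappa> * (n - 1) / sqrt (2 * (n + 1))) powr (- 2 * (n + 1) / (n - 1)) \<and>
      C_minus n \<kappa> \<le> C_ex n \<kappa> y \<and> C_ex n \<kappa> y \<le> C_plus n \<kappa>)"
proof -
  interpret bvp n \<kappa> y using assms by unfold_locales
  \<comment> \<open>The denominator of \<open>lam\<close> is nonzero, so \<open>lam\<close> is a
    genuine quotient and not the default value of division by zero.\<close>
  have "y_plus n \<kappa> 0 - y_bullet n \<kappa> 0 \<noteq> 0"
    using y_plus_bullet_0 by simp
  then show ?thesis
    by (intro conjI impI ballI boundary_layer C_plus_formula y_minus_0 y_minus_1
        y_minus_strict_mono y_minus_convex y_minus_pos y_diff_antimono lower_envelope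
        C_minus_formula C_minus_le_C C_le_C_plus upper_envelope[folded y_plus_env])
qed

end
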